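(* A finite abstract simplicial complex $G$ can be recovered both from the graph $\psi(G)$ and from the graph $\phi(G)$. That is, for all finite abstract simplicial complexes $G$ and $H$: if the graphs $\psi(G)$ and $\psi(H)$ are isomorphic, then $G$ and $H$ are isomorphic simplicial complexes; and if the graphs $\phi(G)$ and $\phi(H)$ are isomorphic, then $G$ and $H$ are isomorphic simplicial complexes.
   Context: A finite abstract simplicial complex $G$ is a finite set of finite non-empty sets that is closed under taking non-empty subsets. Its connection graph $\psi(G)$ is the finite simple graph whose vertices are the elements of $G$, two distinct elements $a,b\in G$ being adjacent iff $a\cap b\neq\emptyset$. Its Barycentric refinement graph $\phi(G)$ is the finite simple graph whose vertices are the elements of $G$, two distinct elements $a,b$ being adjacent iff $a\subset b$ or $b\subset a$. The graphs are regarded as abstract graphs (only the graph structure is known, not which set each vertex represents). An isomorphism of simplicial complexes $G\to H$ is a bijection $T:G\to H$ with $x\subset y$ iff $T(x)\subset T(y)$. *)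

theory Defs
  imports "Graph_Theory.Graph_Theory"
begin

definition abstract_simplicial_complex :: "'a set set \<Rightarrow> bool" where
  "abstract_simplicial_complex G \<longleftrightarrow>
     finite G \<and> (\<forall>x\<in>G. finite x \<and> x \<noteq> {}) \<and>
     (\<forall>x\<in>G. \<forall>y. y \<subseteq> x \<and> y \<noteq> {} \<longrightarrow> y \<in> G)"

definition complex_iso :: "'a set set \<Rightarrow> 'b set set \<Rightarrow> bool" where
  "complex_iso G H \<longleftrightarrow>
     (\<exists>T. bij_betw T G H \<and> (\<forall>x\<in>G. \<forall>y\<in>G. x \<subseteq> y \<longleftrightarrow> T x \<subseteq> T y))"

text \<open>
  Finite simple graphs are represented as finite, loop-free, symmetric digraphs
  (\<^locale>\<open>pair_graph\<close>): an edge between \<open>a\<close> and \<open>b\<close> is the pair of arcs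
  \<open>(a, b)\<close>, \<open>(b, a)\<close>.
\<close>

definition connection_graph :: "'a set set \<Rightarrow> 'a set pair_pre_digraph" where
  "connection_graph G =
     \<lparr> pverts = G,
       parcs = {(a, b). a \<in> G \<and> b \<in> G \<and> a \<noteq> b \<and> a \<inter> b \<noteq> {}} \<rparr>"

definition barycentric_graph :: "'a set set \<Rightarrow> 'a set pair_pre_digraph" where
  "barycentric_graph G =
     \<lparr> pverts = G,
       parcs = {(a, b). a \<in> G \<and> b \<in> G \<and> a \<noteq> b \<and> (a \<subseteq> b \<or> b \<subseteq> a)} \<rparr>"

definition graph_iso :: "'a pair_pre_digraph \<Rightarrow> 'b pair_pre_digraph \<Rightarrow> bool" where
  "graph_iso A B \<longleftrightarrow> digraph_iso (with_proj A) (with_proj B)"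

lemma pair_graph_connection_graph:
  assumes "abstract_simplicial_complex G"
  shows "pair_graph (connection_graph G)"
proof
  have fin: "finite G"
    using assms by (simp add: abstract_simplicial_complex_def)
  then show "finite (pverts (connection_graph G))"
    by (simp add: connection_graph_def)
  show "finite (parcs (connection_graph G))"
    by (rule finite_subset[of _ "G \<times> G"]) (auto simp: connection_graph_def fin)
  show "symmetric (with_proj (connection_graph G))"
    by (auto simp: symmetric_def connection_graph_def intro!: symI)
qed (auto simp: connection_graph_def)

lemma pair_graph_barycentric_graph:
  assumes "abstract_simplicial_complex G"
  shows "pair_graph (barycentric_graph G)"
proof
  have fin: "finite G"
    using assms by (simp add: abstract_simplicial_complex_def)
  then show "finite (pverts (barycentric_graph G))"
    by (simp add: barycentric_graph_def)
  show "finite (parcs (barycentric_graph G))"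
    by (rule finite_subset[of _ "G \<times> G"]) (auto simp: barycentric_graph_def fin)
  show "symmetric (with_proj (barycentric_graph G))"
    by (auto simp: symmetric_def barycentric_graph_def intro!: symI)
qed (auto simp: barycentric_graph_def)

text \<open>
  On these graphs an isomorphism is a bijection of the vertices that preserves and
  reflects adjacency; the arc component of a digraph isomorphism carries no extra data.
\<close>

lemma graph_iso_iff:
  assumes "pair_wf_digraph A" and "pair_wf_digraph B"
  shows "graph_iso A B \<longleftrightarrow>
    (\<exists>f. bij_betw f (pverts A) (pverts B) \<and>
      (\<forall>u\<in>pverts A. \<forall>v\<in>pverts A. (u, v) \<in> parcs A \<longleftrightarrow> (f u, f v) \<in> parcs B))"
    (is "_ \<longleftrightarrow> (\<exists>f. ?iso f)")
proof
  interpret A: pair_wf_digraph A by fact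
  assume "graph_iso A B"
  then obtain h where h: "pre_digraph.digraph_isomorphism (with_proj A) h"
      and B: "with_proj B = app_iso h (with_proj A)"
    by (auto simp: graph_iso_def digraph_iso_def)
  let ?f = "iso_verts h"
  have pv: "pverts B = ?f ` pverts A" and pa: "parcs B = iso_arcs h ` parcs A"
      and tl: "iso_tail h = fst" and hd: "iso_head h = snd"
    using arg_cong[OF B, of verts] arg_cong[OF B, of arcs]
      arg_cong[OF B, of tail] arg_cong[OF B, of head] by simp_all
  have inj: "inj_on ?f (pverts A)"
      and arc: "\<And>e. e \<in> parcs A \<Longrightarrow> iso_arcs h e = (?f (fst e), ?f (snd e))"
    using h by (auto simp: pre_digraph.digraph_isomorphism_def tl hd prod_eq_iff)
  have "(u, v) \<in> parcs A \<longleftrightarrow> (?f u, ?f v) \<in> parcs B"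
    if "u \<in> pverts A" "v \<in> pverts A" for u v
  proof
    assume "(u, v) \<in> parcs A"
    then show "(?f u, ?f v) \<in> parcs B"
      unfolding pa using arc[of "(u, v)"] by (metis fst_conv snd_conv image_eqI)
  next
    assume "(?f u, ?f v) \<in> parcs B"
    then obtain u' v' where e: "(u', v') \<in> parcs A" "(?f u, ?f v) = iso_arcs h (u', v')"
      unfolding pa by auto
    then have "?f u = ?f u'" "?f v = ?f v'"
      using arc[OF e(1)] by auto
    then have "u = u'" "v = v'"
      using inj that A.wellformed'[OF e(1)] by (auto dest: inj_onD)
    then show "(u, v) \<in> parcs A" using e(1) by simp
  qed
  then have "?iso ?f" using pv inj by (auto simp: bij_betw_def)
  then show "\<exists>f. ?iso f" by (rule exI[where x = ?f])
next
  interpret A: pair_wf_digraph A by fact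
  interpret B: pair_wf_digraph B by fact
  assume "\<exists>f. ?iso f"
  then obtain f where f: "bij_betw f (pverts A) (pverts B)"
      and adj: "\<And>u v. u \<in> pverts A \<Longrightarrow> v \<in> pverts A \<Longrightarrow>
        (u, v) \<in> parcs A \<longleftrightarrow> (f u, f v) \<in> parcs B"
    by blast
  have inj: "inj_on f (pverts A)" and img: "f ` pverts A = pverts B"
    using f by (auto simp: bij_betw_def)
  let ?h = "\<lparr> iso_verts = f, iso_arcs = map_prod f f, iso_head = snd, iso_tail = fst \<rparr>"
  have "parcs A \<subseteq> pverts A \<times> pverts A"
    using A.wellformed' by auto
  then have "inj_on (map_prod f f) (parcs A)"
    using inj_on_subset[OF map_prod_inj_on[OF inj inj]] by blast
  moreover have "wf_digraph (with_proj A)" by unfold_locales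
  ultimately have iso: "pre_digraph.digraph_isomorphism (with_proj A) ?h"
    using inj by (auto simp: pre_digraph.digraph_isomorphism_def)
  have "parcs B = map_prod f f ` parcs A"
  proof (intro subset_antisym subrelI)
    fix x y assume e: "(x, y) \<in> parcs B"
    then obtain u v where "u \<in> pverts A" "v \<in> pverts A" "x = f u" "y = f v"
      using B.wellformed'[OF e] img by blast
    then show "(x, y) \<in> map_prod f f ` parcs A"
      using adj e by (metis map_prod_imageI)
  next
    fix x y assume "(x, y) \<in> map_prod f f ` parcs A"
    then obtain u v where e: "(u, v) \<in> parcs A" and xy: "x = f u" "y = f v"
      by auto
    show "(x, y) \<in> parcs B"
      using adj[OF A.wellformed'[OF e]] e unfolding xy by blast
  qed
  then have "with_proj B = app_iso ?h (with_proj A)"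
    using img by (simp add: with_proj_def app_iso_def)
  then show "graph_iso A B"
    unfolding graph_iso_def digraph_iso_def using iso by blast
qed

end

theory Submission
  imports Defs
begin

text \<open>
  The connection graph shows inclusion directly: \<open>x \<subseteq> y\<close> holds iff every face that meets \<open>x\<close> also
  meets \<open>y\<close>, because the faces to be tested include the vertices of \<open>x\<close>. So every isomorphism of
  connection graphs is already an isomorphism of complexes.

  The Barycentric graph only shows which faces are nested, not which one is the smaller, and an
  isomorphism \<open>f\<close> of Barycentric graphs need not respect inclusion. It is therefore replaced by a
  better map, separately on each connected component.

  The reason for rigidity is that if \<open>x\<close> and \<open>x'\<close> are both nested with \<open>z\<close> but not with each other,
  then \<open>f x\<close> and \<open>f x'\<close> are on the same side of \<open>f z\<close>; otherwise \<open>f z\<close> would lie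
  between them and make them nested (\<open>forcing\<close>). Non-nested pairs are so abundant that on a connected complex which is
  not a full simplex, \<open>f\<close> is monotone throughout or antitone throughout (\<open>monotone_or_antitone\<close>).

  A monotone \<open>f\<close> is an isomorphism of complexes. If \<open>f\<close> is antitone, it suffices to find an
  order-reversing bijection of the complex onto itself and to compose \<open>f\<close> with it
  (\<open>reversal_exists\<close>). Here \<open>f x\<close> can be read as the set of facets that contain \<open>x\<close>, and
  \<open>card x + card (f x)\<close> is a constant \<open>M\<close>. For \<open>M = 3\<close> the complex is a cycle, and rotating its
  Barycentric graph by one step exchanges vertices and edges. For \<open>M \<ge> 4\<close> the complex is the
  boundary of a simplex, and taking complements reverses it.

  A component that is a full simplex is recognised by a face nested with all others, and it is
  determined by its number of faces. Since \<open>f\<close> maps components onto components, the isomorphisms of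
  the components can be glued.
\<close>

section \<open>Complexes and nested faces\<close>

abbreviation nested :: "'a set \<Rightarrow> 'a set \<Rightarrow> bool" where
  "nested x y \<equiv> x \<subseteq> y \<or> y \<subseteq> x"

lemma complex_face:
  assumes "abstract_simplicial_complex G" "x \<in> G" "y \<subseteq> x" "y \<noteq> {}"
  shows "y \<in> G"
  using assms unfolding abstract_simplicial_complex_def by blast

lemma complex_vertex:
  assumes "abstract_simplicial_complex G" "x \<in> G" "a \<in> x"
  shows "{a} \<in> G"
  using complex_face[OF assms(1,2), of "{a}"] assms(3) by simp

lemma complex_nonempty:
  assumes "abstract_simplicial_complex G" "x \<in> G"
  shows "x \<noteq> {}"
  using assms unfolding abstract_simplicial_complex_def by blast

lemma complex_finite_face:
  assumes "abstract_simplicial_complex G" "x \<in> G"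
  shows "finite x"
  using assms unfolding abstract_simplicial_complex_def by blast

lemma complex_finite:
  assumes "abstract_simplicial_complex G"
  shows "finite G"
  using assms unfolding abstract_simplicial_complex_def by blast

text \<open>
  Connectedness of the Barycentric graph, in the form that is used as an induction principle:
  what holds at one face and passes between nested faces holds everywhere.
\<close>

definition linked :: "'a set set \<Rightarrow> bool" where
  "linked G \<longleftrightarrow>
     (\<forall>S\<subseteq>G. S \<noteq> {} \<longrightarrow> (\<forall>x\<in>S. \<forall>y\<in>G. nested x y \<longrightarrow> y \<in> S) \<longrightarrow> S = G)"

lemma linked_induct:
  assumes "linked G" "x0 \<in> G" "P x0" "y \<in> G"
    and step: "\<And>x y. x \<in> G \<Longrightarrow> P x \<Longrightarrow> y \<in> G \<Longrightarrow> nested x y \<Longrightarrow> P y"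
  shows "P y"
proof -
  have "{x \<in> G. P x} = G"
    using assms(1)[unfolded linked_def, rule_format, of "{x \<in> G. P x}"] assms(2,3) step
    by blast
  then show ?thesis using assms(4) by blast
qed

section \<open>Comparability isomorphisms\<close>

text \<open>
  An isomorphism of Barycentric graphs. It sends nested faces to nested faces, but for
  \<open>x \<subset> y\<close> it may have \<open>f x \<subset> f y\<close> or \<open>f y \<subset> f x\<close>; the lemmas below control this choice.
\<close>

locale nested_iso =
  fixes G :: "'a set set" and H :: "'b set set" and f :: "'a set \<Rightarrow> 'b set"
  assumes complex_G: "abstract_simplicial_complex G"
    and complex_H: "abstract_simplicial_complex H"
    and bij: "bij_betw f G H"
    and nested_iff: "\<And>x y. x \<in> G \<Longrightarrow> y \<in> G \<Longrightarrow> nested (f x) (f y) \<longleftrightarrow> nested x y"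
begin

lemma image_mem: "x \<in> G \<Longrightarrow> f x \<in> H"
  using bij by (auto simp: bij_betw_def)

lemma inj: "x \<in> G \<Longrightarrow> y \<in> G \<Longrightarrow> f x = f y \<longleftrightarrow> x = y"
  using bij by (auto simp: bij_betw_def dest: inj_onD)

lemma strict_image:
  assumes "x \<in> G" "y \<in> G" "nested x y" "x \<noteq> y"
  shows "f x \<subset> f y \<longleftrightarrow> \<not> f y \<subset> f x"
  using assms nested_iff[of x y] inj[of x y] by blast

text \<open>
  Opposite choices on the two sides would give, say, \<open>f x \<subset> f z \<subset> f x'\<close>, which makes the faces
  \<open>x\<close> and \<open>x'\<close> nested. Every rigidity statement below is a chain of applications of this lemma.
\<close>

lemma forcing:
  assumes "x \<in> G" "x' \<in> G" "z \<in> G" "\<not> nested x x'" "nested x z" "nested x' z"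
  shows "f x \<subset> f z \<longleftrightarrow> f x' \<subset> f z"
proof -
  have "x \<noteq> z" "x' \<noteq> z" using assms by auto
  moreover have "\<not> nested (f x) (f x')" using assms nested_iff by blast
  ultimately show ?thesis
    using strict_image[of x z] strict_image[of x' z] assms by blast
qed

lemma strictly_monotone_imp_iso:
  assumes "\<And>x y. x \<in> G \<Longrightarrow> y \<in> G \<Longrightarrow> x \<subset> y \<Longrightarrow> f x \<subset> f y"
  shows "complex_iso G H"
proof -
  have "x \<subseteq> y \<longleftrightarrow> f x \<subseteq> f y" if "x \<in> G" "y \<in> G" for x y
    using assms[OF that] assms[OF that(2,1)] nested_iff[OF that] inj[OF that] by blast
  then show ?thesis unfolding complex_iso_def using bij by blast
qed

text \<open>
  Testing against the vertices of \<open>z\<close> suffices, because all proper faces of \<open>z\<close> behave alike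
  (lemma \<open>upward_iff\<close>). A vertex has no proper faces, and its value is meaningless; this is why the
  lemmas that compare \<open>upward\<close> exclude one-element faces.
\<close>

definition upward :: "'a set \<Rightarrow> bool" where
  "upward z \<longleftrightarrow> (\<exists>a\<in>z. f {a} \<subset> f z)"

text \<open>
  Non-nestedness connects the proper faces of \<open>z\<close>: two distinct vertices are not nested, and a
  proper face \<open>x\<close> is not nested with a vertex \<open>b\<close> outside \<open>x\<close>. So \<open>forcing\<close> spreads the choice made
  at one proper face to all of them.
\<close>

lemma upward_iff:
  assumes "z \<in> G" "x \<in> G" "x \<subset> z"
  shows "f x \<subset> f z \<longleftrightarrow> upward z"
proof -
  obtain b where b: "b \<in> z" "b \<notin> x" using assms by blast
  have V: "{a} \<in> G" if "a \<in> z" for a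
    using complex_vertex[OF complex_G] assms that by blast
  have x: "f x \<subset> f z \<longleftrightarrow> f {b} \<subset> f z"
    using b assms complex_nonempty[OF complex_G assms(2)]
    by (intro forcing V) auto
  have "f {a} \<subset> f z \<longleftrightarrow> f {b} \<subset> f z" if "a \<in> z" for a
  proof (cases "a = b")
    case False
    then show ?thesis using b that assms by (intro forcing V) auto
  qed simp
  then show ?thesis unfolding upward_def using x b by metis
qed

text \<open>
  The common vertex lies below both faces, so \<open>forcing\<close> applies with the vertex as the third
  face.
\<close>

lemma upward_shared_incomparable:
  assumes "z \<in> G" "z' \<in> G" "\<not> nested z z'" "v \<in> z" "v \<in> z'"
  shows "upward z \<longleftrightarrow> upward z'"
proof -
  have V: "{v} \<in> G" "{v} \<subset> z" "{v} \<subset> z'"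
    using complex_vertex[OF complex_G] assms by blast+
  have "f z \<subset> f {v} \<longleftrightarrow> f z' \<subset> f {v}"
    using assms V by (intro forcing) auto
  moreover have "f {v} \<subset> f z \<longleftrightarrow> \<not> f z \<subset> f {v}"
    using assms V by (intro strict_image) auto
  moreover have "f {v} \<subset> f z' \<longleftrightarrow> \<not> f z' \<subset> f {v}"
    using assms V by (intro strict_image) auto
  ultimately show ?thesis
    using upward_iff[OF assms(1) V(1,2)] upward_iff[OF assms(2) V(1,3)] by metis
qed

lemma edge_leaving_face:
  assumes "linked G" "t \<in> G" "y \<in> G" "\<not> y \<subseteq> t"
  obtains v w where "v \<in> t" "w \<notin> t" "{v, w} \<in> G"
proof -
  have "\<exists>x y. x \<in> G \<and> x \<subseteq> t \<and> y \<in> G \<and> nested x y \<and> \<not> y \<subseteq> t"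
    using linked_induct[of G t "\<lambda>x. x \<subseteq> t" y] assms by blast
  then obtain x y where xy: "x \<in> G" "x \<subseteq> t" "y \<in> G" "x \<subseteq> y" "\<not> y \<subseteq> t"
    by blast
  then obtain v w where "v \<in> x" "w \<in> y" "w \<notin> t"
    using complex_nonempty[OF complex_G] by blast
  then show thesis
    using that[of v w] complex_face[OF complex_G, of y "{v, w}"] xy by blast
qed

text \<open>
  An edge \<open>{v, w}\<close> leaving \<open>z'\<close> is not nested with any face of \<open>z'\<close> that has more than one vertex.
  It therefore compares \<open>z\<close> with \<open>z'\<close>, at the price of one more edge \<open>{u, v}\<close> when \<open>z\<close> misses \<open>v\<close>.
  In a full simplex there is no such edge, and the top face may indeed behave differently from
  the faces on its boundary.
\<close>

lemma upward_shared_subset: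
  assumes "linked G" and nonsimplex: "\<And>t. t \<in> G \<Longrightarrow> \<exists>y\<in>G. \<not> y \<subseteq> t"
    and "z \<in> G" "z' \<in> G" "z \<subset> z'" "u \<in> z" "z \<noteq> {u}"
  shows "upward z \<longleftrightarrow> upward z'"
proof -
  obtain v w where vw: "v \<in> z'" "w \<notin> z'" "{v, w} \<in> G"
    using edge_leaving_face assms by metis
  obtain u' where u': "u' \<in> z" "u' \<noteq> u" using assms by blast
  then have "\<not> nested z' {v, w}" using vw u' assms by blast
  then have z': "upward z' \<longleftrightarrow> upward {v, w}"
    using vw assms by (intro upward_shared_incomparable[of _ _ v]) auto
  show ?thesis
  proof (cases "v \<in> z")
    case True
    have "\<not> nested z {v, w}" using True vw assms u' by blast
    then show ?thesis using True vw assms z'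
      using upward_shared_incomparable[of z "{v, w}" v] by blast
  next
    case False
    have uv: "{u, v} \<in> G"
      using complex_face[OF complex_G, of z' "{u, v}"] vw assms by blast
    have "\<not> nested z {u, v}" using False u' assms by blast
    then have "upward z \<longleftrightarrow> upward {u, v}"
      using uv u' False assms by (intro upward_shared_incomparable[of _ _ u]) auto
    moreover have "\<not> nested {u, v} {v, w}" using False vw assms by blast
    then have "upward {u, v} \<longleftrightarrow> upward {v, w}"
      using uv vw False assms by (intro upward_shared_incomparable[of _ _ v]) auto
    ultimately show ?thesis using z' by blast
  qed
qed

lemma upward_shared:
  assumes "linked G" and nonsimplex: "\<And>t. t \<in> G \<Longrightarrow> \<exists>y\<in>G. \<not> y \<subseteq> t"
    and "z \<in> G" "z' \<in> G" "v \<in> z" "v \<in> z'" "z \<noteq> {v}" "z' \<noteq> {v}"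
  shows "upward z \<longleftrightarrow> upward z'"
  using upward_shared_incomparable[of z z' v] upward_shared_subset[of z z' v]
    upward_shared_subset[of z' z v] assms by blast

lemma upward_constant:
  assumes "linked G" and nonsimplex: "\<And>t. t \<in> G \<Longrightarrow> \<exists>y\<in>G. \<not> y \<subseteq> t"
    and "e \<in> G" "a \<in> e" "e \<noteq> {a}" and "z \<in> G" "b \<in> z" "z \<noteq> {b}"
  shows "upward z \<longleftrightarrow> upward e"
proof -
  \<comment> \<open>Vertices carry no value of their own, so the induction property speaks of all
    larger faces.\<close>
  let ?P = "\<lambda>x. \<forall>y\<in>G. x \<subseteq> y \<longrightarrow> (\<exists>c\<in>y. y \<noteq> {c}) \<longrightarrow> upward y = upward e"
  have "?P z"
  proof (rule linked_induct[OF \<open>linked G\<close> \<open>e \<in> G\<close> _ \<open>z \<in> G\<close>])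
    show "?P e"
      using upward_shared[OF assms(1) nonsimplex, of _ e a] assms by blast
  next
    fix x y assume xy: "x \<in> G" "?P x" "y \<in> G" "nested x y"
    show "?P y"
    proof (cases "x \<subseteq> y")
      case True
      then show ?thesis using xy by blast
    next
      case False
      then have yx: "y \<subset> x" using xy by blast
      obtain v where v: "v \<in> y" using complex_nonempty[OF complex_G] xy by blast
      then have vx: "v \<in> x" "x \<noteq> {v}" using yx by blast+
      then have "upward x = upward e" using xy(1,2) by blast
      moreover have "upward y' = upward x"
        if y': "y' \<in> G" "y \<subseteq> y'" "\<exists>c\<in>y'. y' \<noteq> {c}" for y'
      proof -
        have "v \<in> y'" "y' \<noteq> {v}" using v y' by blast+
        then show ?thesis
          using upward_shared[OF assms(1) nonsimplex y'(1) xy(1) _ vx(1) _ vx(2)] by blast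
      qed
      ultimately show ?thesis by blast
    qed
  qed
  then show ?thesis using assms by blast
qed

lemma monotone_or_antitone:
  assumes "linked G" and nonsimplex: "\<And>t. t \<in> G \<Longrightarrow> \<exists>y\<in>G. \<not> y \<subseteq> t"
  shows "(\<forall>x\<in>G. \<forall>y\<in>G. x \<subset> y \<longrightarrow> f x \<subset> f y) \<or> (\<forall>x\<in>G. \<forall>y\<in>G. x \<subset> y \<longrightarrow> f y \<subset> f x)"
proof -
  have up: "f x \<subset> f y \<longleftrightarrow> upward y" if "x \<in> G" "y \<in> G" "x \<subset> y" for x y
    using upward_iff that by blast
  have "upward y = upward y'" if "x \<in> G" "y \<in> G" "x \<subset> y" "x' \<in> G" "y' \<in> G" "x' \<subset> y'" for x y x' y'
  proof -
    have "x \<noteq> {}" "x' \<noteq> {}" using complex_nonempty[OF complex_G] that(1,4) by blast+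
    then obtain a b where "a \<in> x" "b \<in> x'" by blast
    then have "a \<in> y" "y \<noteq> {a}" "b \<in> y'" "y' \<noteq> {b}" using that by blast+
    then show ?thesis
      using upward_constant[OF assms that(5) _ _ that(2)] by blast
  qed
  then show ?thesis using up strict_image by (metis psubset_imp_subset psubset_eq)
qed

end


section \<open>Rotating a cycle\<close>

text \<open>
  A finite connected graph in which every vertex has two neighbours is a cycle, and \<open>s\<close> moves
  every vertex one step along it. To find the cycle, walk without turning back until a vertex
  repeats for the first time: a first repetition away from the starting point would give the
  repeated vertex a third neighbour, so the walk closes up at its start, and by connectedness it
  has visited everything.
\<close>

lemma cycle_rotation:
  fixes adj :: "'v \<Rightarrow> 'v \<Rightarrow> bool"
  assumes fin: "finite X"
    and sym: "\<And>x y. adj x y \<Longrightarrow> adj y x"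
    and irrefl: "\<And>x. \<not> adj x x"
    and deg: "\<And>x. x \<in> X \<Longrightarrow> card {y \<in> X. adj x y} = 2"
    and conn: "\<And>S. S \<subseteq> X \<Longrightarrow> S \<noteq> {} \<Longrightarrow> (\<And>x y. x \<in> S \<Longrightarrow> y \<in> X \<Longrightarrow> adj x y \<Longrightarrow> y \<in> S) \<Longrightarrow> S = X"
  obtains s where "bij_betw s X X" "\<And>x. x \<in> X \<Longrightarrow> adj x (s x)"
    "\<And>x y. x \<in> X \<Longrightarrow> y \<in> X \<Longrightarrow> adj (s x) (s y) \<longleftrightarrow> adj x y"
proof (cases "X = {}")
  case True
  show thesis by (rule that[of id]) (use True in auto)
next
  case False
  have two: "y = a \<or> y = b"
    if xX: "x \<in> X" and "a \<in> X" "b \<in> X" "adj x a" "adj x b" "a \<noteq> b" "y \<in> X" "adj x y" for x a b y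
  proof -
    obtain c d where "{y \<in> X. adj x y} = {c, d}"
      using deg[OF xX] unfolding card_2_iff by blast
    then have "a \<in> {c, d}" "b \<in> {c, d}" "y \<in> {c, d}" using that by blast+
    then show ?thesis using \<open>a \<noteq> b\<close> by blast
  qed
  have other: "\<exists>y. y \<in> X \<and> adj x y \<and> y \<noteq> a" if xX: "x \<in> X" for x a
  proof -
    obtain c d where "{y \<in> X. adj x y} = {c, d}" "c \<noteq> d"
      using deg[OF xX] unfolding card_2_iff by blast
    then show ?thesis by blast
  qed
  obtain x0 where x0: "x0 \<in> X" using False by blast
  obtain x1 where x1: "x1 \<in> X" "adj x0 x1" using other[OF x0] by blast
  define walk where "walk e \<longleftrightarrow> fst e \<in> X \<and> snd e \<in> X \<and> adj (fst e) (snd e)" for e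
  have "\<exists>q. \<forall>n. walk (q n) \<and> fst (q (Suc n)) = snd (q n) \<and> snd (q (Suc n)) \<noteq> fst (q n)"
  proof (rule dependent_nat_choice)
    show "\<exists>e. walk e" by (rule exI[of _ "(x0, x1)"]) (simp add: walk_def x0 x1)
  next
    fix e :: "'v \<times> 'v" and n :: nat
    assume e: "walk e"
    then obtain y where "y \<in> X" "adj (snd e) y" "y \<noteq> fst e"
      using other[of "snd e" "fst e"] unfolding walk_def by blast
    then show "\<exists>e'. walk e' \<and> fst e' = snd e \<and> snd e' \<noteq> fst e"
      using e by (intro exI[of _ "(snd e, y)"]) (simp add: walk_def)
  qed
  then obtain q where q: "\<And>n. walk (q n)" "\<And>n. fst (q (Suc n)) = snd (q n)"
      "\<And>n. snd (q (Suc n)) \<noteq> fst (q n)"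
    by blast
  define p where "p n = fst (q n)" for n
  have pX: "p n \<in> X" for n using q(1)[of n] by (simp add: p_def walk_def)
  have padj: "adj (p n) (p (Suc n))" for n
    using q(1)[of n] q(2)[of n] by (simp add: p_def walk_def)
  have pback: "p (Suc (Suc n)) \<noteq> p n" for n
    using q(3)[of n] by (simp add: p_def q(2))
  have nbr_Suc: "y = p n \<or> y = p (Suc (Suc n))" if "y \<in> X" "adj (p (Suc n)) y" for n y
    using two[OF pX pX pX sym[OF padj] padj pback[symmetric] that] .
  define repeated where "repeated j \<longleftrightarrow> (\<exists>i<j. p i = p j)" for j
  have "\<not> inj p"
    using fin pX finite_subset[of "range p" X] finite_imageD[of p UNIV] by auto
  then obtain i j where "p i = p j" "i < j"
    unfolding inj_def by (metis linorder_neqE_nat)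
  then have "repeated j" unfolding repeated_def by blast
  define n where "n = (LEAST j. repeated j)"
  have "repeated n" unfolding n_def by (rule LeastI) fact
  then obtain i where i: "i < n" "p i = p n" unfolding repeated_def by blast
  have "\<not> repeated j" if "j < n" for j using that not_less_Least unfolding n_def by blast
  then have distinct: "i = j" if "i < n" "j < n" "p i = p j" for i j
    using that unfolding repeated_def by (metis linorder_neqE_nat)
  obtain k where k: "n = Suc k" using i(1) by (cases n) auto
  \<comment> \<open>Loops and immediate backtracking are impossible, so the closed part of the walk has
    length at least three.\<close>
  have "n \<noteq> Suc i" using padj[of i] i(2) irrefl by auto
  moreover have "n \<noteq> Suc (Suc i)" using pback[of i] i(2) by auto
  ultimately have ik: "Suc i < k" using i(1) k by linarith
  have pk: "adj (p i) (p k)" using padj[of k] sym k i(2) by simp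
  \<comment> \<open>Otherwise \<open>p k\<close>, the last step before the repetition, is a neighbour of \<open>p i\<close>,
    so it equals \<open>p (i - 1)\<close> or \<open>p (i + 1)\<close>, which is an earlier repetition.\<close>
  have "i = 0"
  proof (cases i)
    case (Suc i')
    then have "p k = p i' \<or> p k = p (Suc i)" using nbr_Suc[OF pX[of k], of i'] pk by simp
    then show ?thesis using distinct[of k i'] distinct[of k "Suc i"] ik k Suc by auto
  qed simp
  then have pn: "p n = p 0" and k1: "1 < k" and pk: "adj (p 0) (p k)"
    using i ik pk by auto
  have nbr_0: "y = p k \<or> y = p (Suc 0)" if "y \<in> X" "adj (p 0) y" for y
  proof -
    have "p k \<noteq> p (Suc 0)" using distinct[of k "Suc 0"] k1 k by auto
    then show ?thesis using two[OF pX pX pX pk padj[of 0] _ that] by blast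
  qed
  have next_mem: "p (Suc m) \<in> p ` {..<n}" if "m < n" for m
    using that pn k1 k by (cases "Suc m = n") auto
  have X: "p ` {..<n} = X"
  proof (rule conn)
    show "p ` {..<n} \<subseteq> X" using pX by blast
    show "p ` {..<n} \<noteq> {}" using k by auto
    fix x y assume "x \<in> p ` {..<n}" "y \<in> X" "adj x y"
    then obtain m where m: "m < n" "x = p m" by blast
    show "y \<in> p ` {..<n}"
    proof (cases m)
      case 0
      then show ?thesis using nbr_0[OF \<open>y \<in> X\<close>] \<open>adj x y\<close> m k k1 by auto
    next
      case (Suc m')
      then have "y = p m' \<or> y = p (Suc m)" using nbr_Suc[OF \<open>y \<in> X\<close>] \<open>adj x y\<close> m by simp
      then show ?thesis using next_mem[OF m(1)] m(1) Suc by auto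
    qed
  qed
  define s where "s x = p (Suc (inv_into {..<n} p x))" for x
  have "inj_on p {..<n}" using distinct by (auto intro: inj_onI)
  then have s: "s (p m) = p (Suc m)" if "m < n" for m
    using that by (simp add: s_def)
  have s_adj: "adj x (s x)" if "x \<in> X" for x
    using that padj s unfolding X[symmetric] by auto
  have "s ` X \<subseteq> X" unfolding s_def using pX by blast
  moreover have "X \<subseteq> s ` X"
  proof
    fix x assume "x \<in> X"
    then obtain m where m: "m < n" "x = p m" unfolding X[symmetric] by blast
    show "x \<in> s ` X"
    proof (cases m)
      case 0
      then have "x = s (p k)" using s[of k] pn m k by simp
      then show ?thesis using pX by blast
    next
      case (Suc m')
      then have "x = s (p m')" using s[of m'] m by simp
      then show ?thesis using pX by blast
    qed
  qed
  ultimately have bij: "bij_betw s X X"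
    using finite_surj_inj[OF fin] unfolding bij_betw_def by blast
  have nbr: "y = s x \<or> x = s y" if xy: "x \<in> X" "y \<in> X" "adj x y" for x y
  proof -
    obtain m where m: "m < n" "x = p m" using xy(1) unfolding X[symmetric] by blast
    show ?thesis
    proof (cases m)
      case 0
      then show ?thesis using nbr_0[OF xy(2)] xy(3) m s[of 0] s[of k] pn k by auto
    next
      case (Suc m')
      then have "y = p m' \<or> y = p (Suc m)" using nbr_Suc[OF xy(2)] xy(3) m by simp
      then show ?thesis using s[of m] s[of m'] m Suc by auto
    qed
  qed
  have sX: "s x \<in> X" if "x \<in> X" for x using \<open>s ` X \<subseteq> X\<close> that by blast
  have s_inj: "x = y" if "x \<in> X" "y \<in> X" "s x = s y" for x y
    using bij that unfolding bij_betw_def by (blast dest: inj_onD)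
  have "adj (s x) (s y) \<longleftrightarrow> adj x y" if xy: "x \<in> X" "y \<in> X" for x y
  proof
    assume "adj x y"
    then consider "y = s x" | "x = s y" using nbr xy by blast
    then show "adj (s x) (s y)" using s_adj sX xy sym by cases auto
  next
    assume "adj (s x) (s y)"
    then consider "s y = s (s x)" | "s x = s (s y)" using nbr sX xy by blast
    then show "adj x y"
    proof cases
      case 1
      then show ?thesis using s_inj[of y "s x"] sX xy s_adj by metis
    next
      case 2
      then show ?thesis using s_inj[of x "s y"] sX xy s_adj sym by metis
    qed
  qed
  then show thesis using that[of s] bij s_adj by blast
qed


section \<open>Complexes with an order-reversing isomorphism\<close>

lemma card_proper_nonempty_subsets_of_pair:
  assumes "card e = 2"
  shows "card {y. y \<subset> e \<and> y \<noteq> {}} = 2"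
proof -
  obtain a b where "e = {a, b}" "a \<noteq> b" using assms unfolding card_2_iff by blast
  then have "{y. y \<subset> e \<and> y \<noteq> {}} = {{a}, {b}}" by blast
  then show ?thesis using \<open>a \<noteq> b\<close> by auto
qed

lemma subset_iff_nested_card:
  assumes "finite x" "finite y"
  shows "x \<subseteq> y \<longleftrightarrow> x = y \<or> nested x y \<and> card x < card y"
  using assms psubset_card_mono[of x y] psubset_card_mono[of y x] card_mono[of x y]
  by (metis card_mono linorder_not_less psubsetI order_refl)

text \<open>
  If a connected complex that is not a simplex has a reversed copy, then strictly above every
  vertex it looks like the boundary of a simplex upside down. This is so restrictive that the complex is a
  cycle or the boundary of a simplex; in particular it has an order-reversing bijection onto
  itself, which turns the reversed copy into an ordinary one.
\<close>

locale linked_antitone_iso =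
  fixes G :: "'a set set" and H :: "'b set set" and f :: "'a set \<Rightarrow> 'b set"
  assumes complex_G: "abstract_simplicial_complex G"
    and complex_H: "abstract_simplicial_complex H"
    and bij: "bij_betw f G H"
    and anti: "\<And>x y. x \<in> G \<Longrightarrow> y \<in> G \<Longrightarrow> f y \<subseteq> f x \<longleftrightarrow> x \<subseteq> y"
    and linked_G: "linked G"
    and nonsimplex: "\<And>t. t \<in> G \<Longrightarrow> \<exists>y\<in>G. \<not> y \<subseteq> t"
begin

lemma image_mem: "x \<in> G \<Longrightarrow> f x \<in> H"
  using bij by (auto simp: bij_betw_def)

lemma inj: "x \<in> G \<Longrightarrow> y \<in> G \<Longrightarrow> f x = f y \<longleftrightarrow> x = y"
  using bij by (auto simp: bij_betw_def dest: inj_onD)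

lemma finite_face: "x \<in> G \<Longrightarrow> finite x"
  using complex_finite_face[OF complex_G] .

lemma finite_image: "x \<in> G \<Longrightarrow> finite (f x)"
  using complex_finite_face[OF complex_H image_mem] .

lemma card_pos: "x \<in> G \<Longrightarrow> 0 < card x"
  using complex_nonempty[OF complex_G] finite_face by (simp add: card_gt_0_iff)

lemma card_image_pos: "x \<in> G \<Longrightarrow> 0 < card (f x)"
  using complex_nonempty[OF complex_H image_mem] finite_image by (simp add: card_gt_0_iff)

text \<open>
  The faces above \<open>y\<close> correspond to the nonempty subsets of \<open>f y\<close>.
\<close>

lemma preimage:
  assumes "y \<in> G" "S \<subseteq> f y" "S \<noteq> {}"
  obtains z where "z \<in> G" "y \<subseteq> z" "f z = S"
proof -
  have "S \<in> H" using complex_face[OF complex_H image_mem] assms by blast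
  then obtain z where "z \<in> G" "f z = S" using bij unfolding bij_betw_def by blast
  then show thesis using that[of z] anti[of y z] assms by blast
qed

text \<open>
  If \<open>f y\<close> had two more elements than \<open>f (insert w y)\<close>, then a set strictly between them would
  be the image of a face strictly between \<open>y\<close> and \<open>insert w y\<close>.
\<close>

lemma card_image_insert:
  assumes "y \<in> G" "insert w y \<in> G" "w \<notin> y"
  shows "card (f y) = Suc (card (f (insert w y)))"
proof -
  have "f (insert w y) \<subseteq> f y" "f (insert w y) \<noteq> f y"
    using anti[OF assms(1,2)] inj[OF assms(2,1)] assms(3) by blast+
  then obtain a where a: "a \<in> f y" "a \<notin> f (insert w y)" by blast
  then obtain z where z: "z \<in> G" "y \<subseteq> z" "f z = insert a (f (insert w y))"
    using preimage[OF assms(1), of "insert a (f (insert w y))"] \<open>f (insert w y) \<subseteq> f y\<close>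
    by (metis insert_not_empty insert_subset)
  then have "z \<subseteq> insert w y" using anti[OF z(1) assms(2)] by blast
  moreover have "z \<noteq> insert w y" using z(3) a(2) by blast
  ultimately have "z = y" using z(2) by blast
  then show ?thesis using z(3) a(2) finite_image[OF assms(2)] by simp
qed

lemma weight_subface:
  assumes "z \<in> G" "y \<subseteq> z" "y \<noteq> {}"
  shows "card y + card (f y) = card z + card (f z)"
proof -
  have "card (f y) = card D + card (f (y \<union> D))"
    if "finite D" "y \<inter> D = {}" "y \<union> D \<in> G" for D
    using that
  proof (induction D rule: finite_induct)
    case (insert w D)
    have D: "y \<union> D \<in> G"
      using complex_face[OF complex_G insert.prems(2), of "y \<union> D"] assms(3) by blast
    then have "card (f y) = card D + card (f (y \<union> D))" using insert by blast
    moreover have "card (f (y \<union> D)) = Suc (card (f (insert w (y \<union> D))))"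
      using D insert by (intro card_image_insert) auto
    ultimately show ?case using insert by simp
  qed simp
  from this[of "z - y"]
  have "card (f y) = card (z - y) + card (f z)"
    using assms finite_face[OF assms(1)] by (simp add: Un_absorb1)
  moreover have "card z = card y + card (z - y)"
    using assms finite_face[OF assms(1)]
    by (metis card_Diff_subset card_mono finite_subset le_add_diff_inverse)
  ultimately show ?thesis by simp
qed

text \<open>
  The number \<open>card x + card (f x)\<close> is called the weight of \<open>x\<close>. Passing to a larger face moves
  units from the second summand to the first, so the weight is constant on a connected complex;
  it is one more than the common number of vertices of the facets, and one more than the common
  number of facets at a vertex.
\<close>

lemma weight_constant:
  assumes "x \<in> G" "y \<in> G"
  shows "card x + card (f x) = card y + card (f y)"
proof -
  have "card y + card (f y) = card x + card (f x)"
  proof (rule linked_induct[OF linked_G assms(1) _ assms(2)])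
    fix u v assume "u \<in> G" "card u + card (f u) = card x + card (f x)" "v \<in> G" "nested u v"
    then show "card v + card (f v) = card x + card (f x)"
      using weight_subface[of u v] weight_subface[of v u] complex_nonempty[OF complex_G]
      by metis
  qed simp
  then show ?thesis by simp
qed

text \<open>
  With a smaller weight all faces are vertices, and a connected complex of this kind is a point,
  which is a simplex.
\<close>

lemma weight_ge_3:
  assumes "x \<in> G"
  shows "3 \<le> card x + card (f x)"
proof (rule ccontr)
  assume small: "\<not> ?thesis"
  obtain y where y: "y \<in> G" "\<not> y \<subseteq> x" using nonsimplex assms by blast
  have card1: "card z = 1" if "z \<in> G" for z
    using weight_constant[OF that assms] small card_pos[OF that] card_image_pos[OF that] by simp
  have "y = x"
  proof (rule linked_induct[OF linked_G assms _ y(1)])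
    fix u v assume "u \<in> G" "u = x" "v \<in> G" "nested u v"
    then show "v = x"
      using card1 finite_face card_subset_eq by metis
  qed simp
  then show False using y(2) by blast
qed

text \<open>
  Faces of weight 3 are edges, with two proper faces and nothing above, or vertices, with two
  edges above them and nothing below.
\<close>

lemma card_nested_of_weight_3:
  assumes "x \<in> G" "card x + card (f x) = 3"
  shows "card {y \<in> G. nested x y \<and> x \<noteq> y} = 2"
proof (cases "card x = 2")
  case True
  have "\<not> x \<subset> y" if "y \<in> G" for y
    using weight_constant[OF assms(1) that] assms(2) card_image_pos[OF that] True
      psubset_card_mono[OF finite_face[OF that], of x] by linarith
  then have "{y \<in> G. nested x y \<and> x \<noteq> y} = {y. y \<subset> x \<and> y \<noteq> {}}"
    using complex_face[OF complex_G assms(1)] complex_nonempty[OF complex_G] by blast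
  then show ?thesis using card_proper_nonempty_subsets_of_pair[OF True] by simp
next
  case False
  then have x: "card x = 1" "card (f x) = 2"
    using assms(2) card_pos[OF assms(1)] card_image_pos[OF assms(1)] by linarith+
  let ?N = "{y \<in> G. nested x y \<and> x \<noteq> y}"
  have "\<not> y \<subset> x" if "y \<in> G" for y
    using psubset_card_mono[OF finite_face[OF assms(1)], of y] x(1) card_pos[OF that] by linarith
  then have N: "?N = {y \<in> G. x \<subset> y}" by blast
  have "f ` ?N = {S. S \<subset> f x \<and> S \<noteq> {}}"
  proof (intro subset_antisym subsetI)
    fix S assume "S \<in> f ` ?N"
    then obtain y where "y \<in> G" "x \<subset> y" "S = f y" unfolding N by blast
    then show "S \<in> {S. S \<subset> f x \<and> S \<noteq> {}}"
      using anti[OF assms(1), of y] inj[OF assms(1), of y] complex_nonempty[OF complex_H image_mem, of y]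
      by auto
  next
    fix S assume "S \<in> {S. S \<subset> f x \<and> S \<noteq> {}}"
    then obtain y where "y \<in> G" "x \<subseteq> y" "f y = S" "S \<noteq> f x"
      using preimage[OF assms(1), of S] by auto
    then show "S \<in> f ` ?N" unfolding N by blast
  qed
  moreover have "inj_on f ?N" using inj by (auto intro: inj_onI)
  then have "card (f ` ?N) = card ?N" by (rule card_image)
  ultimately show ?thesis
    using card_proper_nonempty_subsets_of_pair[OF x(2)] by simp
qed

text \<open>
  In weight 3 the Barycentric graph is a cycle on which vertices and edges alternate. Rotating it
  by one step exchanges the two kinds of faces and preserves nestedness, so it reverses
  inclusions.
\<close>

lemma reversal_of_weight_3:
  assumes weight: "\<And>x. x \<in> G \<Longrightarrow> card x + card (f x) = 3"
  obtains s where "bij_betw s G G" "\<And>x y. x \<in> G \<Longrightarrow> y \<in> G \<Longrightarrow> s y \<subseteq> s x \<longleftrightarrow> x \<subseteq> y"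
proof -
  let ?adj = "\<lambda>x y :: 'a set. nested x y \<and> x \<noteq> y"
  have conn: "S = G"
    if S: "S \<subseteq> G" "S \<noteq> {}" "\<And>x y. x \<in> S \<Longrightarrow> y \<in> G \<Longrightarrow> ?adj x y \<Longrightarrow> y \<in> S" for S
  proof -
    have "\<forall>x\<in>S. \<forall>y\<in>G. nested x y \<longrightarrow> y \<in> S" using S(3) by blast
    then show ?thesis using linked_G S(1,2) unfolding linked_def by blast
  qed
  obtain s where bij_s: "bij_betw s G G"
    and s_adj: "\<And>x. x \<in> G \<Longrightarrow> ?adj x (s x)"
    and s_iff: "\<And>x y. x \<in> G \<Longrightarrow> y \<in> G \<Longrightarrow> ?adj (s x) (s y) \<longleftrightarrow> ?adj x y"
  proof (rule cycle_rotation[of G ?adj])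
    show "finite G" using complex_finite[OF complex_G] .
    show "card {y \<in> G. ?adj x y} = 2" if "x \<in> G" for x
      using card_nested_of_weight_3[OF that weight[OF that]] .
    show "S = G"
      if "S \<subseteq> G" "S \<noteq> {}" "\<And>x y. x \<in> S \<Longrightarrow> y \<in> G \<Longrightarrow> ?adj x y \<Longrightarrow> y \<in> S" for S
      using conn that by blast
  qed blast+
  have sG: "s x \<in> G" if "x \<in> G" for x using bij_s that by (auto simp: bij_betw_def)
  have card_s: "card (s x) = 3 - card x" if x: "x \<in> G" for x
  proof -
    have ne: "card x \<noteq> card (s x)"
      using s_adj[OF x] finite_face[OF x] finite_face[OF sG[OF x]] card_subset_eq by metis
    have "card y = 1 \<or> card y = 2" if "y \<in> G" for y
      using weight[OF that] card_pos[OF that] card_image_pos[OF that] by linarith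
    from this[OF x] this[OF sG[OF x]] ne show ?thesis by auto
  qed
  have "s y \<subseteq> s x \<longleftrightarrow> x \<subseteq> y" if xy: "x \<in> G" "y \<in> G" for x y
  proof -
    have "card x < 3" "card y < 3"
      using weight[OF xy(1)] weight[OF xy(2)] card_image_pos[OF xy(1)] card_image_pos[OF xy(2)]
      by linarith+
    then have "card (s y) < card (s x) \<longleftrightarrow> card x < card y"
      using card_s xy by auto
    moreover have "s y = s x \<longleftrightarrow> x = y"
      using bij_s xy unfolding bij_betw_def by (blast dest: inj_onD)
    moreover have "nested (s y) (s x) \<longleftrightarrow> nested x y"
      using s_iff[OF xy] \<open>s y = s x \<longleftrightarrow> x = y\<close> by auto
    ultimately show ?thesis
      using subset_iff_nested_card[of x y] subset_iff_nested_card[of "s y" "s x"]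
        finite_face sG xy by metis
  qed
  then show thesis using that bij_s by blast
qed

lemma mem_image_iff:
  assumes "s \<in> G" "f s = {a}" "y \<in> G"
  shows "a \<in> f y \<longleftrightarrow> y \<subseteq> s"
  using anti[OF assms(3,1)] assms(2) by simp

text \<open>
  The set \<open>U\<close> consists of \<open>v\<close> and its neighbours. The elements of \<open>F = f {v}\<close> index the facets
  through \<open>v\<close>, and the neighbours \<open>w a\<close> of \<open>v\<close> are indexed by \<open>F\<close> as well: the edge \<open>{v, w a}\<close> lies in
  all facets through \<open>v\<close> except \<open>facet a\<close>. Counting facets, \<open>w a\<close> lies on exactly one further facet
  \<open>t a\<close>. Because the weight is at least 4, any two neighbours \<open>w a\<close> and \<open>w b\<close> lie on a common facet
  through \<open>v\<close>; so they span an edge, and the count for this edge forces \<open>t a = t b\<close>. The common facet is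
  opposite to \<open>v\<close>: it consists of all the \<open>w a\<close>. Now all facets at the vertices of \<open>U\<close> are known; they
  are the sets \<open>U - {u}\<close> with \<open>u \<in> U\<close>, and connectedness leaves no room for anything else.
\<close>

lemma boundary_of_weight_ge_4:
  assumes v: "{v} \<in> G" and weight: "\<And>x. x \<in> G \<Longrightarrow> card x + card (f x) = M" and M: "4 \<le> M"
  obtains U where "finite U" "G = {x. x \<subset> U \<and> x \<noteq> {}}"
proof -
  define F where "F = f {v}"
  have finF: "finite F" unfolding F_def using finite_image[OF v] .
  have cardF: "Suc (card F) = M" unfolding F_def using weight[OF v] by simp
  have "\<exists>s. s \<in> G \<and> f s = {a} \<and> v \<in> s" if "a \<in> F" for a
    using preimage[OF v, of "{a}"] that unfolding F_def by auto
  then obtain facet where facet: "\<And>a. a \<in> F \<Longrightarrow> facet a \<in> G"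
      "\<And>a. a \<in> F \<Longrightarrow> f (facet a) = {a}" "\<And>a. a \<in> F \<Longrightarrow> v \<in> facet a"
    by metis
  have "\<exists>w. w \<noteq> v \<and> {v, w} \<in> G \<and> f {v, w} = F - {a}" if a: "a \<in> F" for a
  proof -
    have "card (F - {a}) = M - 2" using a finF cardF by simp
    then have "card (F - {a}) \<noteq> 0" using M by simp
    then have "F - {a} \<noteq> {}" by (metis card.empty)
    then obtain e where e: "e \<in> G" "{v} \<subseteq> e" "f e = F - {a}"
      using preimage[OF v, of "F - {a}"] unfolding F_def by blast
    then have "card e = 2" using weight[of e] \<open>card (F - {a}) = M - 2\<close> M by simp
    then obtain w where "e = {v, w}" "w \<noteq> v" using e(2) unfolding card_2_iff by blast
    then show ?thesis using e by blast
  qed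
  then obtain w where w: "\<And>a. a \<in> F \<Longrightarrow> w a \<noteq> v" "\<And>a. a \<in> F \<Longrightarrow> {v, w a} \<in> G"
      "\<And>a. a \<in> F \<Longrightarrow> f {v, w a} = F - {a}"
    by metis
  have wG: "{w a} \<in> G" if "a \<in> F" for a
    using complex_vertex[OF complex_G w(2)[OF that]] by blast
  have w_inj: "a = b" if "a \<in> F" "b \<in> F" "w a = w b" for a b
    using w(3)[OF that(1)] w(3)[OF that(2)] that by auto
  have w_facet: "w a \<in> facet b \<longleftrightarrow> a \<noteq> b" if ab: "a \<in> F" "b \<in> F" for a b
    using mem_image_iff[OF facet(1,2)[OF ab(2)] w(2)[OF ab(1)]] facet(3)[OF ab(2)] w(3)[OF ab(1)] ab
    by auto
  have "\<exists>t. t \<notin> F \<and> f {w a} = insert t (F - {a})" if a: "a \<in> F" for a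
  proof -
    have sub: "F - {a} \<subseteq> f {w a}"
      using anti[OF wG[OF a] w(2)[OF a]] w(3)[OF a] by simp
    have "a \<notin> f {w a}"
      using mem_image_iff[OF facet(1,2)[OF a] wG[OF a]] w_facet[OF a a] by simp
    have "card (f {w a} - (F - {a})) = 1"
      using weight[OF wG[OF a]] sub finF cardF a card_Diff_subset[of "F - {a}" "f {w a}"] M by simp
    then obtain t where t: "f {w a} - (F - {a}) = {t}" using card_1_singletonE by blast
    then have "t \<notin> F" using \<open>a \<notin> f {w a}\<close> by blast
    moreover have "f {w a} = insert t (F - {a})" using t sub by blast
    ultimately show ?thesis by blast
  qed
  then obtain t where t: "\<And>a. a \<in> F \<Longrightarrow> t a \<notin> F" "\<And>a. a \<in> F \<Longrightarrow> f {w a} = insert (t a) (F - {a})"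
    by metis
  have t_eq: "t a = t b" if ab: "a \<in> F" "b \<in> F" for a b
  proof (rule ccontr)
    assume ne: "t a \<noteq> t b"
    then have "a \<noteq> b" by blast
    then have cardFab: "card (F - {a, b}) = M - 3"
      using ab finF cardF by (simp add: card_Diff_subset)
    then have "card (F - {a, b}) \<noteq> 0" using M by simp
    then have "F - {a, b} \<noteq> {}" by (metis card.empty)
    then obtain c where c: "c \<in> F" "c \<noteq> a" "c \<noteq> b" by blast
    have "w a \<in> facet c" "w b \<in> facet c" using w_facet ab c by blast+
    then have e: "{w a, w b} \<in> G"
      using complex_face[OF complex_G facet(1)[OF c(1)], of "{w a, w b}"] by blast
    have "w a \<noteq> w b" using w_inj[OF ab] \<open>a \<noteq> b\<close> by blast
    then have "card {w a, w b} = 2" by simp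
    then have "card (f {w a, w b}) = M - 2" using weight[OF e] by simp
    moreover have "f {w a, w b} \<subseteq> f {w a} \<inter> f {w b}"
      using anti[OF wG[OF ab(1)] e] anti[OF wG[OF ab(2)] e] by blast
    then have "f {w a, w b} \<subseteq> F - {a, b}" using t ab ne by auto
    then have "card (f {w a, w b}) \<le> M - 3"
      using card_mono[of "F - {a, b}"] finF cardFab by (metis finite_Diff)
    ultimately show False using M by simp
  qed
  have "F \<noteq> {}" using cardF M by auto
  then obtain a0 where a0: "a0 \<in> F" by blast
  define \<tau> where "\<tau> = t a0"
  have \<tau>: "\<tau> \<notin> F" "\<And>a. a \<in> F \<Longrightarrow> f {w a} = insert \<tau> (F - {a})"
    unfolding \<tau>_def using t a0 t_eq by metis+
  have "{\<tau>} \<subseteq> f {w a0}" using \<tau>(2)[OF a0] by simp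
  then obtain opp where opp: "opp \<in> G" "f opp = {\<tau>}"
    by (metis preimage[OF wG[OF a0]] insert_not_empty)
  have card_wF: "card (w ` F) = card F"
    using w_inj by (intro card_image inj_onI)
  have "w ` F \<subseteq> opp"
    using mem_image_iff[OF opp wG] \<tau>(2) by blast
  moreover have "card opp = card (w ` F)"
    using weight[OF opp(1)] opp(2) cardF card_wF by simp
  ultimately have opp_eq: "opp = w ` F"
    using card_subset_eq[OF finite_face[OF opp(1)]] by metis
  define U where "U = insert v (w ` F)"
  have "v \<notin> w ` F" using w(1) by blast
  have finU: "finite U" unfolding U_def using finF by simp
  have cardU: "card U = M" unfolding U_def using \<open>v \<notin> w ` F\<close> finF card_wF cardF by simp
  have facet_eq: "facet a = U - {w a}" if a: "a \<in> F" for a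
  proof -
    have "U - {w a} \<subseteq> facet a" unfolding U_def using facet(3) w_facet a by blast
    moreover have "card (U - {w a}) = card (facet a)"
      using weight[OF facet(1)[OF a]] facet(2)[OF a] cardU a finU unfolding U_def by simp
    ultimately show ?thesis using card_subset_eq[OF finite_face[OF facet(1)[OF a]]] by metis
  qed
  have proper: "x \<in> G" if x: "x \<subset> U" "x \<noteq> {}" for x
  proof (cases "v \<in> x")
    case True
    then obtain a where "a \<in> F" "w a \<notin> x" using x unfolding U_def by blast
    then have "x \<subseteq> facet a" using facet_eq x by blast
    then show ?thesis using complex_face[OF complex_G facet(1)[OF \<open>a \<in> F\<close>]] x(2) by blast
  next
    case False
    then have "x \<subseteq> opp" unfolding opp_eq using x U_def by blast
    then show ?thesis using complex_face[OF complex_G opp(1)] x(2) by blast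
  qed
  have vertex_image: "f {u} \<subseteq> insert \<tau> F" if "u \<in> U" for u
    using that \<tau>(2) unfolding U_def F_def by blast
  \<comment> \<open>Every face at a vertex of \<open>U\<close> lies in one of the facets already found.\<close>
  have closed: "y \<subset> U" if y: "y \<in> G" "u \<in> y" "u \<in> U" for y u
  proof -
    obtain b where b: "b \<in> f y" using complex_nonempty[OF complex_H image_mem[OF y(1)]] by blast
    have "f y \<subseteq> f {u}" using anti[of "{u}" y] complex_vertex[OF complex_G y(1,2)] y by blast
    then consider "b = \<tau>" | "b \<in> F" using b vertex_image[OF y(3)] by blast
    then show ?thesis
    proof cases
      case 1
      then have "y \<subseteq> w ` F" using mem_image_iff[OF opp y(1)] b opp_eq by blast
      then show ?thesis unfolding U_def using \<open>v \<notin> w ` F\<close> by blast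
    next
      case 2
      then have "y \<subseteq> U - {w b}"
        using mem_image_iff[OF facet(1,2)[OF 2] y(1)] b facet_eq[OF 2] by blast
      then show ?thesis unfolding U_def using 2 by blast
    qed
  qed
  have "x \<subset> U" if x: "x \<in> G" for x
  proof (rule linked_induct[OF linked_G v _ x])
    show "{v} \<subset> U" using closed[OF v, of v] unfolding U_def by blast
    fix x y assume "x \<in> G" "x \<subset> U" "y \<in> G" "nested x y"
    then show "y \<subset> U"
      using closed[of y] complex_nonempty[OF complex_G] by blast
  qed
  then have "G = {x. x \<subset> U \<and> x \<noteq> {}}"
    using proper complex_nonempty[OF complex_G] by blast
  then show thesis using that finU by blast
qed

lemma reversal_exists:
  obtains s where "bij_betw s G G" "\<And>x y. x \<in> G \<Longrightarrow> y \<in> G \<Longrightarrow> s y \<subseteq> s x \<longleftrightarrow> x \<subseteq> y"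
proof (cases "G = {}")
  case True
  show thesis by (rule that[of id]) (use True in auto)
next
  case False
  then obtain x where x: "x \<in> G" by blast
  then obtain v where "v \<in> x" using complex_nonempty[OF complex_G] by blast
  then have v: "{v} \<in> G" using complex_vertex[OF complex_G x] by blast
  define M where "M = card x + card (f x)"
  have weight: "card y + card (f y) = M" if "y \<in> G" for y
    unfolding M_def using weight_constant that x by blast
  show thesis
  proof (cases "M = 3")
    case True
    then show thesis using reversal_of_weight_3 weight that by blast
  next
    case False
    then have "4 \<le> M" using weight_ge_3[OF x] unfolding M_def by simp
    then obtain U where U: "G = {x. x \<subset> U \<and> x \<noteq> {}}"
      using boundary_of_weight_ge_4[OF v weight] by metis
    show thesis
    proof (rule that)
      show "bij_betw (\<lambda>x. U - x) G G"
        by (rule bij_betw_byWitness[of _ "\<lambda>x. U - x"]) (auto simp: U)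
      show "U - y \<subseteq> U - x \<longleftrightarrow> x \<subseteq> y" if "x \<in> G" "y \<in> G" for x y
        using that unfolding U by blast
    qed
  qed
qed

lemma reversed_complexes_iso: "complex_iso G H"
proof -
  obtain s where s: "bij_betw s G G"
      "\<And>x y. x \<in> G \<Longrightarrow> y \<in> G \<Longrightarrow> s y \<subseteq> s x \<longleftrightarrow> x \<subseteq> y"
    by (rule reversal_exists) blast
  have sG: "s x \<in> G" if "x \<in> G" for x using s(1) that by (auto simp: bij_betw_def)
  have "bij_betw (f \<circ> s) G H" using bij_betw_trans[OF s(1) bij] .
  moreover have "x \<subseteq> y \<longleftrightarrow> (f \<circ> s) x \<subseteq> (f \<circ> s) y" if "x \<in> G" "y \<in> G" for x y
    using anti[OF sG sG] s(2) that by simp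
  ultimately show ?thesis unfolding complex_iso_def by blast
qed

end


section \<open>Linked complexes\<close>

lemma simplex_iso:
  fixes t :: "'a set" and u :: "'b set"
  assumes "finite t" "finite u" "G = Pow t - {{}}" "H = Pow u - {{}}" "card G = card H"
  shows "complex_iso G H"
proof -
  have "card G = 2 ^ card t - 1" "card H = 2 ^ card u - 1"
    using assms(1-4) by (simp_all add: card_Diff_subset card_Pow)
  moreover have "(1::nat) \<le> 2 ^ card t" "(1::nat) \<le> 2 ^ card u" by simp_all
  ultimately have "(2::nat) ^ card t = 2 ^ card u" using assms(5) by linarith
  then have "card t = card u" by simp
  then obtain h where h: "bij_betw h t u"
    using finite_same_card_bij assms(1,2) by blast
  have inj: "inj_on h t" using h by (simp add: bij_betw_def)
  have "bij_betw ((`) h) (Pow t) (Pow u)" using bij_betw_Pow[OF h] .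
  then have "bij_betw ((`) h) G H"
    unfolding assms(3,4) bij_betw_def
    by (auto simp: inj_on_image_set_diff[of _ "Pow t"] intro: inj_on_subset)
  moreover have "x \<subseteq> y \<longleftrightarrow> h ` x \<subseteq> h ` y" if "x \<in> G" "y \<in> G" for x y
    using that inj_on_image_mem_iff[OF inj, of _ y] assms(3) by blast
  ultimately show ?thesis unfolding complex_iso_def by blast
qed

text \<open>
  A vertex outside \<open>u\<close>, taken as a face, cannot be nested with the nonempty set \<open>u\<close>.
\<close>

lemma cone_face_is_top:
  assumes H: "abstract_simplicial_complex H" and u: "u \<in> H"
    and cone: "\<And>y. y \<in> H \<Longrightarrow> nested u y"
  shows "H = Pow u - {{}}"
proof -
  have "y \<subseteq> u" if y: "y \<in> H" for y
  proof
    fix w assume w: "w \<in> y"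
    then have "nested u {w}" using cone complex_vertex[OF H y] by blast
    then show "w \<in> u" using complex_nonempty[OF H u] by blast
  qed
  then show ?thesis
    using complex_face[OF H u] complex_nonempty[OF H] by blast
qed

context nested_iso
begin

text \<open>
  In a simplex the image of the top face is nested with every face, so the other complex is a
  simplex too and counting faces shows that they have the same dimension; \<open>f\<close> itself need be
  neither monotone nor antitone in this case. A connected complex that is not a simplex leaves only
  these two options, and the antitone one is repaired by composing with a reversal.
\<close>

lemma linked_imp_iso:
  assumes "linked G"
  shows "complex_iso G H"
proof (cases "\<exists>t\<in>G. \<forall>y\<in>G. y \<subseteq> t")
  case True
  then obtain t where t: "t \<in> G" "\<And>y. y \<in> G \<Longrightarrow> y \<subseteq> t" by blast
  have "G = Pow t - {{}}"
    using t complex_face[OF complex_G t(1)] complex_nonempty[OF complex_G] by blast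
  moreover have "H = Pow (f t) - {{}}"
  proof (rule cone_face_is_top[OF complex_H image_mem[OF t(1)]])
    fix y assume "y \<in> H"
    then obtain x where "x \<in> G" "y = f x" using bij unfolding bij_betw_def by blast
    then show "nested (f t) y" using nested_iff[OF t(1)] t(2) by blast
  qed
  ultimately show ?thesis
    using simplex_iso[of t "f t"] complex_finite_face[OF complex_G t(1)]
      complex_finite_face[OF complex_H image_mem[OF t(1)]] bij_betw_same_card[OF bij] by blast
next
  case False
  then have nonsimplex: "\<exists>y\<in>G. \<not> y \<subseteq> t" if "t \<in> G" for t using that by blast
  from monotone_or_antitone[OF assms nonsimplex] show ?thesis
  proof
    assume "\<forall>x\<in>G. \<forall>y\<in>G. x \<subset> y \<longrightarrow> f x \<subset> f y"
    then show ?thesis by (intro strictly_monotone_imp_iso) blast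
  next
    assume anti: "\<forall>x\<in>G. \<forall>y\<in>G. x \<subset> y \<longrightarrow> f y \<subset> f x"
    interpret linked_antitone_iso G H f
    proof
      fix x y assume xy: "x \<in> G" "y \<in> G"
      have "x \<subset> y \<Longrightarrow> f y \<subset> f x" "y \<subset> x \<Longrightarrow> f x \<subset> f y" using anti xy by blast+
      then show "f y \<subseteq> f x \<longleftrightarrow> x \<subseteq> y"
        using nested_iff[OF xy] inj[OF xy] by (metis order_refl psubsetE psubsetI)
    qed (use complex_G complex_H bij assms nonsimplex in auto)
    show ?thesis by (rule reversed_complexes_iso)
  qed
qed

end

section \<open>Components\<close>

text \<open>
  A union of components of the Barycentric graph.
\<close>

definition saturated :: "'a set set \<Rightarrow> 'a set set \<Rightarrow> bool" where
  "saturated G K \<longleftrightarrow> K \<subseteq> G \<and> (\<forall>x\<in>K. \<forall>y\<in>G. nested x y \<longrightarrow> y \<in> K)"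

lemma saturated_complex:
  assumes "abstract_simplicial_complex G" "saturated G K"
  shows "abstract_simplicial_complex K"
proof -
  have "finite K" using assms complex_finite finite_subset unfolding saturated_def by blast
  moreover have "y \<in> K" if "x \<in> K" "y \<subseteq> x" "y \<noteq> {}" for x y
    using that assms(2) complex_face[OF assms(1), of x y] unfolding saturated_def by blast
  moreover have "finite x \<and> x \<noteq> {}" if "x \<in> K" for x
  proof -
    have "x \<in> G" using that assms(2) unfolding saturated_def by blast
    then show ?thesis using complex_finite_face complex_nonempty assms(1) by blast
  qed
  ultimately show ?thesis unfolding abstract_simplicial_complex_def by blast
qed

definition links :: "'a set set \<Rightarrow> ('a set \<times> 'a set) set" where
  "links G = {(x, y). x \<in> G \<and> y \<in> G \<and> nested x y}"

definition component :: "'a set set \<Rightarrow> 'a set \<Rightarrow> 'a set set" where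
  "component G x = {y \<in> G. (x, y) \<in> (links G)\<^sup>*}"

lemma sym_links: "sym ((links G)\<^sup>*)"
  by (intro sym_rtrancl symI) (auto simp: links_def)

lemma component_self: "x \<in> G \<Longrightarrow> x \<in> component G x"
  by (simp add: component_def)

lemma component_eq:
  assumes "y \<in> component G x"
  shows "component G y = component G x"
proof -
  have xy: "(x, y) \<in> (links G)\<^sup>*" using assms by (simp add: component_def)
  then have "(y, x) \<in> (links G)\<^sup>*" using sym_links[of G] by (blast dest: symD)
  then show ?thesis
    unfolding component_def using xy by (blast intro: rtrancl_trans)
qed

lemma saturated_component: "saturated G (component G x)"
proof -
  have "z \<in> component G x" if "y \<in> component G x" "z \<in> G" "nested y z" for y z
  proof -
    have "(x, y) \<in> (links G)\<^sup>*" "(y, z) \<in> links G"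
      using that by (auto simp: component_def links_def)
    then show ?thesis using that(2) by (simp add: component_def)
  qed
  then show ?thesis unfolding saturated_def component_def by blast
qed

lemma linked_component: "linked (component G x)"
  unfolding linked_def
proof (intro allI impI)
  fix S
  assume sub: "S \<subseteq> component G x" and "S \<noteq> {}"
    and closed: "\<forall>y\<in>S. \<forall>z\<in>component G x. nested y z \<longrightarrow> z \<in> S"
  then obtain s where s: "s \<in> S" by blast
  have comp: "component G s = component G x" using component_eq s sub by blast
  have "y \<in> S" if "(s, y) \<in> (links G)\<^sup>*" for y
    using that
  proof (induction rule: rtrancl_induct)
    case (step y z)
    have yz: "y \<in> component G x" "z \<in> G" "nested y z"
      using step sub by (auto simp: links_def)
    then have "z \<in> component G x" using saturated_component unfolding saturated_def by blast
    then show ?case using closed step.IH yz(3) by blast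
  qed (rule s)
  then show "S = component G x"
    using sub unfolding comp[symmetric] by (auto simp: component_def)
qed

context nested_iso
begin

lemma saturated_image:
  assumes "saturated G K"
  shows "saturated H (f ` K)"
proof -
  have "y \<in> f ` K" if x: "x \<in> K" and y: "y \<in> H" "nested (f x) y" for x y
  proof -
    obtain z where z: "z \<in> G" "y = f z" using bij y(1) unfolding bij_betw_def by blast
    have "x \<in> G" using assms x unfolding saturated_def by blast
    then have "nested x z" using nested_iff[of x z] z y(2) by blast
    then show ?thesis using assms x z unfolding saturated_def by blast
  qed
  moreover have "f ` K \<subseteq> H"
    using assms bij unfolding saturated_def bij_betw_def by (metis image_mono)
  ultimately show ?thesis unfolding saturated_def by (metis imageE)
qed

lemma component_iso: "complex_iso (component G x) (f ` component G x)"
proof -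
  let ?K = "component G x"
  have K: "?K \<subseteq> G" unfolding component_def by blast
  interpret K: nested_iso ?K "f ` ?K" f
  proof
    show "abstract_simplicial_complex ?K"
      using saturated_complex[OF complex_G saturated_component] .
    show "abstract_simplicial_complex (f ` ?K)"
      using saturated_complex[OF complex_H saturated_image[OF saturated_component]] .
    show "bij_betw f ?K (f ` ?K)" using bij K by (rule bij_betw_subset) simp
    show "nested (f y) (f z) \<longleftrightarrow> nested y z" if "y \<in> ?K" "z \<in> ?K" for y z
      using nested_iff that K by blast
  qed
  show ?thesis using K.linked_imp_iso[OF linked_component] .
qed

text \<open>
  The isomorphisms on the components come from different constructions, so \<open>f\<close> cannot be used
  directly. But the image of each component \<open>K\<close> is still \<open>f ` K\<close>, and these sets are saturated and
  disjoint; hence faces in different components have images that are not nested, and the pieces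
  fit together.
\<close>

lemma complexes_iso: "complex_iso G H"
proof -
  let ?C = "component G"
  have "\<exists>g. bij_betw g K (f ` K) \<and> (\<forall>x\<in>K. \<forall>y\<in>K. x \<subseteq> y \<longleftrightarrow> g x \<subseteq> g y)"
    if "K \<in> ?C ` G" for K
    using component_iso that unfolding complex_iso_def by blast
  then obtain g where g: "\<And>K. K \<in> ?C ` G \<Longrightarrow> bij_betw (g K) K (f ` K)"
      "\<And>K x y. K \<in> ?C ` G \<Longrightarrow> x \<in> K \<Longrightarrow> y \<in> K \<Longrightarrow> x \<subseteq> y \<longleftrightarrow> g K x \<subseteq> g K y"
    by metis
  define T where "T x = g (?C x) x" for x
  have CG: "?C x \<subseteq> G" for x unfolding component_def by blast
  have g_image: "g (?C x) ` ?C x = f ` ?C x" if "x \<in> G" for x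
    using g(1)[of "?C x"] that unfolding bij_betw_def by simp
  have T_mem: "T x \<in> f ` ?C x" if "x \<in> G" for x
    using g_image[OF that] imageI[OF component_self[OF that], of "g (?C x)"] by (simp add: T_def)
  have same: "?C x = ?C y" if xy: "x \<in> G" "y \<in> G" "nested (T x) (T y)" for x y
  proof -
    obtain x' y' where x': "x' \<in> ?C x" "T x = f x'" and y': "y' \<in> ?C y" "T y = f y'"
      using T_mem[OF xy(1)] T_mem[OF xy(2)] by blast
    then have "nested x' y'" using nested_iff[of x' y'] xy(3) CG by auto
    then have "y' \<in> ?C x"
      using saturated_component[of G x] x'(1) y'(1) CG unfolding saturated_def by blast
    then show ?thesis using component_eq[OF y'(1)] component_eq[of y' G x] by simp
  qed
  have same': "?C x = ?C y" if "x \<in> G" "y \<in> G" "nested x y" for x y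
    using saturated_component[of G x] component_self that component_eq[of y G x]
    unfolding saturated_def by blast
  have inj_T: "inj_on T G"
  proof (rule inj_onI)
    fix x y assume xy: "x \<in> G" "y \<in> G" "T x = T y"
    then have C: "?C y = ?C x" using same[OF xy(1,2)] by simp
    then have "g (?C x) x = g (?C x) y" using xy(3) by (simp add: T_def)
    moreover have "inj_on (g (?C x)) (?C x)"
      using g(1)[of "?C x"] xy(1) by (simp add: bij_betw_def)
    moreover have "x \<in> ?C x" "y \<in> ?C x"
      using component_self[OF xy(1)] component_self[OF xy(2)] C by simp_all
    ultimately show "x = y" by (blast dest: inj_onD)
  qed
  have "T ` G = H"
  proof (intro subset_antisym subsetI)
    fix y assume "y \<in> T ` G"
    then obtain x where x: "x \<in> G" "y = T x" by blast
    then obtain x' where "x' \<in> ?C x" "y = f x'" using T_mem by blast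
    then show "y \<in> H" using image_mem CG by blast
  next
    fix y assume "y \<in> H"
    then obtain x where x: "x \<in> G" "y = f x" using bij unfolding bij_betw_def by blast
    then have "y \<in> g (?C x) ` ?C x"
      using g_image component_self by blast
    then obtain x' where x': "x' \<in> ?C x" "y = g (?C x) x'" by blast
    then have "y = T x'" unfolding T_def component_eq[OF x'(1)] by simp
    then show "y \<in> T ` G" using x' CG by blast
  qed
  moreover have "x \<subseteq> y \<longleftrightarrow> T x \<subseteq> T y" if xy: "x \<in> G" "y \<in> G" for x y
  proof (cases "?C x = ?C y")
    case True
    then show ?thesis
      unfolding T_def using g(2)[of "?C y" x y] component_self[OF xy(1)] component_self[OF xy(2)] xy
      by simp
  next
    case False
    then show ?thesis using same same' xy by blast
  qed
  ultimately show ?thesis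
    unfolding complex_iso_def bij_betw_def using inj_T by blast
qed

end

section \<open>Reconstruction\<close>

text \<open>
  For the converse, apply the right-hand side to the vertices of \<open>x\<close>. Thus inclusion of faces is
  inclusion of closed neighbourhoods in the connection graph.
\<close>

lemma face_iff_neighbourhood:
  assumes "abstract_simplicial_complex G" "x \<in> G" "y \<in> G"
  shows "x \<subseteq> y \<longleftrightarrow> (\<forall>z\<in>G. z \<inter> x \<noteq> {} \<longrightarrow> z \<inter> y \<noteq> {})"
proof
  assume R: "\<forall>z\<in>G. z \<inter> x \<noteq> {} \<longrightarrow> z \<inter> y \<noteq> {}"
  show "x \<subseteq> y"
  proof
    fix a assume "a \<in> x"
    then show "a \<in> y" using R complex_vertex[OF assms(1,2)] by blast
  qed
qed blast

lemma connection_graph_iso_imp_iso: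
  fixes G :: "'a set set" and H :: "'b set set"
  assumes G: "abstract_simplicial_complex G" and H: "abstract_simplicial_complex H"
    and "graph_iso (connection_graph G) (connection_graph H)"
  shows "complex_iso G H"
proof -
  interpret G: pair_graph "connection_graph G" using pair_graph_connection_graph[OF G] .
  interpret H: pair_graph "connection_graph H" using pair_graph_connection_graph[OF H] .
  obtain f where f: "bij_betw f G H"
    and arc: "\<And>u v. u \<in> G \<Longrightarrow> v \<in> G \<Longrightarrow>
      (u, v) \<in> parcs (connection_graph G) \<longleftrightarrow> (f u, f v) \<in> parcs (connection_graph H)"
    using assms(3) unfolding graph_iso_iff[OF G.pair_wf_digraph_axioms H.pair_wf_digraph_axioms]
    by (auto simp: connection_graph_def)
  have mem: "f x \<in> H" if "x \<in> G" for x using f that by (auto simp: bij_betw_def)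
  have meet: "u \<inter> v \<noteq> {} \<longleftrightarrow> f u \<inter> f v \<noteq> {}" if uv: "u \<in> G" "v \<in> G" for u v
  proof (cases "u = v")
    case True
    then show ?thesis
      using complex_nonempty[OF G uv(1)] complex_nonempty[OF H mem[OF uv(1)]] by simp
  next
    case False
    then have "f u \<noteq> f v" using f uv unfolding bij_betw_def by (blast dest: inj_onD)
    then show ?thesis
      using arc[OF uv] False uv mem by (simp add: connection_graph_def)
  qed
  have "x \<subseteq> y \<longleftrightarrow> f x \<subseteq> f y" if xy: "x \<in> G" "y \<in> G" for x y
  proof -
    have "(\<forall>z\<in>G. z \<inter> x \<noteq> {} \<longrightarrow> z \<inter> y \<noteq> {}) \<longleftrightarrow>
        (\<forall>z\<in>G. f z \<inter> f x \<noteq> {} \<longrightarrow> f z \<inter> f y \<noteq> {})"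
      using meet xy by simp
    also have "\<dots> \<longleftrightarrow> (\<forall>z\<in>H. z \<inter> f x \<noteq> {} \<longrightarrow> z \<inter> f y \<noteq> {})"
      using f unfolding bij_betw_def by auto
    finally show ?thesis
      using face_iff_neighbourhood[OF G xy] face_iff_neighbourhood[OF H mem[OF xy(1)] mem[OF xy(2)]]
      by simp
  qed
  then show ?thesis unfolding complex_iso_def using f by blast
qed

lemma barycentric_graph_iso_imp_iso:
  fixes G :: "'a set set" and H :: "'b set set"
  assumes G: "abstract_simplicial_complex G" and H: "abstract_simplicial_complex H"
    and "graph_iso (barycentric_graph G) (barycentric_graph H)"
  shows "complex_iso G H"
proof -
  interpret G: pair_graph "barycentric_graph G" using pair_graph_barycentric_graph[OF G] .
  interpret H: pair_graph "barycentric_graph H" using pair_graph_barycentric_graph[OF H] .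
  obtain f where f: "bij_betw f G H"
    and arc: "\<And>u v. u \<in> G \<Longrightarrow> v \<in> G \<Longrightarrow>
      (u, v) \<in> parcs (barycentric_graph G) \<longleftrightarrow> (f u, f v) \<in> parcs (barycentric_graph H)"
    using assms(3) unfolding graph_iso_iff[OF G.pair_wf_digraph_axioms H.pair_wf_digraph_axioms]
    by (auto simp: barycentric_graph_def)
  interpret nested_iso G H f
  proof
    fix x y assume xy: "x \<in> G" "y \<in> G"
    show "nested (f x) (f y) \<longleftrightarrow> nested x y"
    proof (cases "x = y")
      case False
      then have "f x \<noteq> f y" using f xy unfolding bij_betw_def by (blast dest: inj_onD)
      moreover have "f x \<in> H" "f y \<in> H" using f xy by (auto simp: bij_betw_def)
      ultimately show ?thesis
        using arc[OF xy] False xy by (simp add: barycentric_graph_def)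
    qed simp
  qed (use G H f in auto)
  show ?thesis by (rule complexes_iso)
qed

theorem theorem1:
  fixes G :: "'a set set" and H :: "'b set set"
  assumes "abstract_simplicial_complex G" and "abstract_simplicial_complex H"
  shows "(graph_iso (connection_graph G) (connection_graph H) \<longrightarrow> complex_iso G H) \<and>
         (graph_iso (barycentric_graph G) (barycentric_graph H) \<longrightarrow> complex_iso G H)"
  using connection_graph_iso_imp_iso[OF assms] barycentric_graph_iso_imp_iso[OF assms] by blast

end
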